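(* Let $I\subset\mathbb{R}$ be a nondegenerate compact interval, let $p,d\in\mathbb{N}$, let $(\Omega,\mathcal{A},\mathbb{P})$ be a probability space, and let $M:\Omega\to\mathcal{M}_p$ be a random mean generated by a $d$-dimensional random variable $\xi:\Omega\to\mathbb{R}^d$. Then its expected value $\mathbb{E}(M)$ is a non-random mean, that is, $\mathbb{E}(M)\in\mathcal{M}_p$. Further, $$(\mathbb{E}(M))(x)=\int_\Omega (M(\omega))(x)\,\mathrm{d}\mathbb{P}(\omega),\qquad x\in I^p.$$
   Context: $\mathbb{N}$ is the set of positive integers. A nondegenerate interval is one containing at least two distinct points. $\mathcal{B}(\cdot)$ denotes the Borel $\sigma$-algebra. $\mathcal{C}(I^p)$ is the Banach space of real-valued continuous functions on $I^p$ with the supremum norm. $\mathcal{M}_p\subset\mathcal{C}(I^p)$ is the set of $p$-variable (continuous) means on $I$: those $m\in\mathcal{C}(I^p)$ with $\min(x)\le m(x)\le\max(x)$ for all $x\in I^p$, where $\min(x)$ and $\max(x)$ are the minimum and maximum of the coordinates of $x$. Definition (random mean generated by $\xi$). A map $M:\Omega\to\mathcal{M}_p$ is called a ($p$-variable, continuous) random mean (in $I$) generated by $\xi$ if: (i) $M$ is $(\mathcal{A},\mathcal{B}(\mathcal{C}(I^p)))$-measurable; and (ii) there is a $(\mathcal{B}(I^p)\times\mathcal{B}(\mathbb{R}^d),\mathcal{B}(I))$-measurable map $M_\xi:I^p\times\mathbb{R}^d\to I$ such that (a) for every $\omega\in\Omega$ the map $I^p\ni x\mapsto M_\xi(x,\xi(\omega))$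 is in $\mathcal{C}(I^p)$, and (b) $\mathbb{P}(\{\omega\in\Omega:(M(\omega))(x)=M_\xi(x,\xi(\omega))\text{ for every }x\in I^p\})=1$. Expected value. Such an $M$, regarded as a map into the Banach space $\mathcal{C}(I^p)$, is Bochner integrable with respect to $\mathbb{P}$, and its expected value is the Bochner integral $\mathbb{E}(M):=\int_\Omega M(\omega)\,\mathrm{d}\mathbb{P}(\omega)\in\mathcal{C}(I^p)$. *)

theory Defs
  imports "HOL-Probability.Probability"
begin

definition cube :: "real set \<Rightarrow> (real ^ 'p) set" where
  "cube I = {x. \<forall>i. x $ i \<in> I}"

text \<open>
  The Banach space of continuous real functions on a compact set \<open>K\<close>, with the supremum metric.
  Its elements are functions on \<open>K\<close>, made extensional (\<^const>\<open>undefined\<close>) outside \<open>K\<close>; the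
  vector space operations are the pointwise ones on \<open>K\<close>.
\<close>

definition C_space :: "'k::topological_space set \<Rightarrow> ('k \<Rightarrow> real) metric" where
  "C_space K = cfunspace (top_of_set K) euclidean_metric"

lemma mspace_C_space:
  assumes "compact K"
  shows "mspace (C_space K) = {f. continuous_on K f \<and> f \<in> extensional K}"
proof -
  have "Metric_space.mbounded UNIV dist (f ` K)" if "continuous_on K f" for f :: "'a \<Rightarrow> real"
  proof -
    have "bounded (f ` K)"
      using assms that compact_continuous_image compact_imp_bounded by blast
    then show ?thesis
      by (simp add: mbounded_iff_bounded)
  qed
  then show ?thesis
    by (auto simp: C_space_def)
qed

lemma mdist_C_space:
  assumes "f \<in> mspace (C_space K)" "g \<in> mspace (C_space K)" "K \<noteq> {}"
  shows "mdist (C_space K) f g = (SUP x\<in>K. \<bar>f x - g x\<bar>)"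
  using assms
  by (simp add: C_space_def mdist_cfunspace_eq_mdist_funspace Met_TC.fdist_def Met_TC.fspace_def
      dist_real_def image_subset_iff)

definition borel_C :: "'k::topological_space set \<Rightarrow> ('k \<Rightarrow> real) measure" where
  "borel_C K = sigma (mspace (C_space K)) {U. openin (mtopology_of (C_space K)) U}"

text \<open>
  Bochner integration of \<open>C(K)\<close>-valued maps with respect to a finite measure. The library's
  \<^const>\<open>has_bochner_integral\<close> needs a second countable normed space as a type, whereas \<open>C(K)\<close>
  depends on the parameter \<open>K\<close>; the definitions below follow the library's with \<open>C(K)\<close> as the
  carrier. No finiteness of the support of simple functions is required, since the measure is
  meant to be finite.
\<close>

definition simple_C :: "'w measure \<Rightarrow> 'k::topological_space set \<Rightarrow> ('w \<Rightarrow> 'k \<Rightarrow> real) \<Rightarrow> bool" where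
  "simple_C P K s \<longleftrightarrow> simple_function P s \<and> s \<in> space P \<rightarrow> mspace (C_space K)"

definition simple_integral_C :: "'w measure \<Rightarrow> 'k set \<Rightarrow> ('w \<Rightarrow> 'k \<Rightarrow> real) \<Rightarrow> 'k \<Rightarrow> real" where
  "simple_integral_C P K s =
     (\<lambda>x\<in>K. \<Sum>c\<in>s ` space P. measure P {\<omega> \<in> space P. s \<omega> = c} * c x)"

definition has_bochner_integral_C ::
    "'w measure \<Rightarrow> 'k::topological_space set \<Rightarrow> ('w \<Rightarrow> 'k \<Rightarrow> real) \<Rightarrow> ('k \<Rightarrow> real) \<Rightarrow> bool" where
  "has_bochner_integral_C P K f g \<longleftrightarrow>
     f \<in> P \<rightarrow>\<^sub>M borel_C K \<and>
     (\<exists>s. (\<forall>n. simple_C P K (s n)) \<and>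
          (\<lambda>n. \<integral>\<^sup>+\<omega>. ennreal (mdist (C_space K) (f \<omega>) (s n \<omega>)) \<partial>P) \<longlonglongrightarrow> 0 \<and>
          limitin (mtopology_of (C_space K)) (\<lambda>n. simple_integral_C P K (s n)) g sequentially)"

definition bochner_integrable_C ::
    "'w measure \<Rightarrow> 'k::topological_space set \<Rightarrow> ('w \<Rightarrow> 'k \<Rightarrow> real) \<Rightarrow> bool" where
  "bochner_integrable_C P K f \<longleftrightarrow> (\<exists>g. has_bochner_integral_C P K f g)"

definition bochner_integral_C ::
    "'w measure \<Rightarrow> 'k::topological_space set \<Rightarrow> ('w \<Rightarrow> 'k \<Rightarrow> real) \<Rightarrow> 'k \<Rightarrow> real" where
  "bochner_integral_C P K f = (THE g. has_bochner_integral_C P K f g)"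

definition means :: "real set \<Rightarrow> (real ^ 'p \<Rightarrow> real) set" where
  "means I = {m \<in> mspace (C_space (cube I)).
     \<forall>x\<in>cube I. Min (range (($) x)) \<le> m x \<and> m x \<le> Max (range (($) x))}"

definition random_mean ::
    "'w measure \<Rightarrow> real set \<Rightarrow> ('w \<Rightarrow> real ^ 'd) \<Rightarrow> ('w \<Rightarrow> real ^ 'p \<Rightarrow> real) \<Rightarrow> bool" where
  "random_mean P I \<xi> M \<longleftrightarrow>
     M \<in> space P \<rightarrow> means I \<and>
     M \<in> P \<rightarrow>\<^sub>M borel_C (cube I) \<and>
     (\<exists>M\<xi> \<in> restrict_space borel (cube I) \<Otimes>\<^sub>M borel \<rightarrow>\<^sub>M restrict_space borel I.
        (\<forall>\<omega>\<in>space P. (\<lambda>x\<in>cube I. M\<xi> (x, \<xi> \<omega>)) \<in> mspace (C_space (cube I))) \<and>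
        measure P {\<omega> \<in> space P. \<forall>x\<in>cube I. M \<omega> x = M\<xi> (x, \<xi> \<omega>)} = 1)"

definition expected_mean ::
    "'w measure \<Rightarrow> real set \<Rightarrow> ('w \<Rightarrow> real ^ 'p \<Rightarrow> real) \<Rightarrow> real ^ 'p \<Rightarrow> real" where
  "expected_mean P I M = bochner_integral_C P (cube I) M"

end

theory Submission
  imports Defs
begin

text \<open>
  Since \<open>C(K)\<close> is separable for compact \<open>K\<close>, a bounded Borel map into \<open>C(K)\<close> is a pointwise limit of
  simple maps: take the nearest of the first \<open>n\<close> members of a dense sequence. The distances decrease
  to \<open>0\<close> and are dominated, hence tend to \<open>0\<close> in mean. As evaluation at a point is \<open>1\<close>-Lipschitz on
  \<open>C(K)\<close>, the integrals of the simple maps converge uniformly to the pointwise integral; the same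
  estimate shows that any Bochner integral must be the pointwise one. Bounds by the minimum and
  maximum of the coordinates are then preserved because they hold at every point.
\<close>

section \<open>Membership, distance and convergence in C(K)\<close>

lemma C_space_D:
  assumes "compact K" "f \<in> mspace (C_space K)"
  shows "continuous_on K f" "f \<in> extensional K"
  using assms mspace_C_space by auto

lemma restrict_in_C_space:
  assumes "compact K" "continuous_on K f"
  shows "restrict f K \<in> mspace (C_space K)"
  using assms by (auto simp: mspace_C_space cong: continuous_on_cong_simp)

text \<open>A real \<open>SUP\<close> is an upper bound only of a set bounded above; compactness of
  \<open>K\<close> supplies that bound. This is the Lipschitz property of evaluation on which all
  later pointwise estimates rest.\<close>

lemma abs_le_mdist_C_space:
  assumes "compact K" "f \<in> mspace (C_space K)" "g \<in> mspace (C_space K)" "x \<in> K"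
  shows "\<bar>f x - g x\<bar> \<le> mdist (C_space K) f g"
proof -
  have "continuous_on K (\<lambda>x. \<bar>f x - g x\<bar>)"
    using C_space_D assms by (intro continuous_intros) auto
  then have "bdd_above ((\<lambda>x. \<bar>f x - g x\<bar>) ` K)"
    by (intro bounded_imp_bdd_above compact_imp_bounded compact_continuous_image assms(1))
  then show ?thesis
    using assms by (subst mdist_C_space) (auto intro: cSUP_upper)
qed

lemma mdist_C_space_le:
  assumes "f \<in> mspace (C_space K)" "g \<in> mspace (C_space K)" "K \<noteq> {}"
    and "\<And>x. x \<in> K \<Longrightarrow> \<bar>f x - g x\<bar> \<le> e"
  shows "mdist (C_space K) f g \<le> e"
  using assms by (simp add: mdist_C_space cSUP_least)

lemma limitin_C_space_iff:
  "limitin (mtopology_of (C_space K)) s g F \<longleftrightarrow>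
     g \<in> mspace (C_space K) \<and>
     (\<forall>e>0. \<forall>\<^sub>F n in F. s n \<in> mspace (C_space K) \<and> mdist (C_space K) (s n) g < e)"
  by (simp add: mtopology_of_def Metric_space.limitin_metric)

text \<open>Continuity of \<open>g\<close> is not assumed: it is inherited from the
  \<open>s n\<close> through uniform convergence along the nontrivial filter
  \<open>F\<close>.\<close>

lemma limitin_C_spaceI:
  assumes "compact K" "K \<noteq> {}" "F \<noteq> bot" "g \<in> extensional K"
    and "\<And>n. s n \<in> mspace (C_space K)" "uniform_limit K s g F"
  shows "limitin (mtopology_of (C_space K)) s g F"
proof -
  have "continuous_on K g"
    using assms C_space_D(1)[OF assms(1) assms(5)]
    by (intro uniform_limit_theorem[OF _ assms(6,3)]) simp
  then have g: "g \<in> mspace (C_space K)"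
    using assms by (simp add: mspace_C_space)
  have "\<forall>\<^sub>F n in F. mdist (C_space K) (s n) g < e" if "e > 0" for e
  proof -
    \<comment> \<open>Strict bounds at every point give only a weak bound on the supremum, hence
      \<open>e / 2\<close>.\<close>
    have "\<forall>\<^sub>F n in F. \<forall>x\<in>K. dist (s n x) (g x) < e / 2"
      using uniform_limitD[OF assms(6), of "e / 2"] \<open>e > 0\<close> by simp
    then show ?thesis
    proof eventually_elim
      case (elim n)
      then have "mdist (C_space K) (s n) g \<le> e / 2"
        using assms g by (intro mdist_C_space_le) (auto simp: dist_real_def less_imp_le)
      then show ?case using \<open>e > 0\<close> by simp
    qed
  qed
  then show ?thesis
    using g assms(5) by (simp add: limitin_C_space_iff)
qed

lemma limitin_C_space_pointwise:
  assumes "compact K" "limitin (mtopology_of (C_space K)) s g F" "x \<in> K"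
  shows "((\<lambda>n. s n x) \<longlongrightarrow> g x) F"
proof (rule tendstoI)
  fix e :: real assume "e > 0"
  then have *: "\<forall>\<^sub>F n in F. s n \<in> mspace (C_space K) \<and> mdist (C_space K) (s n) g < e"
    using assms(2) by (auto simp: limitin_C_space_iff)
  have g: "g \<in> mspace (C_space K)"
    using assms(2) by (simp add: limitin_C_space_iff)
  from * show "\<forall>\<^sub>F n in F. dist (s n x) (g x) < e"
  proof eventually_elim
    case (elim n)
    then show ?case
      using abs_le_mdist_C_space[OF assms(1) _ g assms(3)] by (fastforce simp: dist_real_def)
  qed
qed

section \<open>Separability of C(K)\<close>

text \<open>
  An element of a countable dense subset is selected for every pair of a mesh and an accuracy and
  every list of rounded values on a finite net: two functions with small oscillation on the mesh
  and the same rounded values on the net are uniformly close.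
\<close>

lemma separable_C_space:
  fixes K :: "'k::metric_space set"
  assumes "compact K" "K \<noteq> {}"
  shows "\<exists>c :: nat \<Rightarrow> 'k \<Rightarrow> real. range c \<subseteq> mspace (C_space K) \<and>
    (\<forall>f\<in>mspace (C_space K). \<forall>e>0. \<exists>n. mdist (C_space K) f (c n) < e)"
proof -
  have "\<exists>xs. set xs \<subseteq> K \<and> K \<subseteq> (\<Union>x\<in>set xs. ball x (1 / real (Suc m)))" for m
  proof -
    obtain T where "finite T" "T \<subseteq> K" "K \<subseteq> (\<Union>x\<in>T. ball x (1 / real (Suc m)))"
      using assms(1) compactE_image[of K K "\<lambda>x. ball x (1 / real (Suc m))"]
      by (metis (no_types, lifting) UN_I centre_in_ball divide_pos_pos less_numeral_extra(1)
          of_nat_0_less_iff open_ball subsetI zero_less_Suc)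
    then show ?thesis
      by (metis finite_list)
  qed
  then obtain xs where xs: "\<And>m. set (xs m) \<subseteq> K"
      "\<And>m. K \<subseteq> (\<Union>x\<in>set (xs m). ball x (1 / real (Suc m)))"
    by metis
  define osc where "osc m e f \<longleftrightarrow>
      (\<forall>x\<in>K. \<forall>y\<in>K. dist x y < 1 / real (Suc m) \<longrightarrow> \<bar>f x - f y\<bar> < e)"
    for m and e :: real and f :: "'k \<Rightarrow> real"
  define rounded where "rounded m e f = map (\<lambda>x. \<lfloor>f x / e\<rfloor>) (xs m)"
    for m and e :: real and f :: "'k \<Rightarrow> real"
  \<comment> \<open>The index is a triple of two naturals and a list of integers, so it ranges over
    a countable type; every function in the carrier belongs to some class
    \<open>Q t\<close>.\<close>
  define Q where "Q = (\<lambda>(m, k, q) f. f \<in> mspace (C_space K) \<and> osc m (1 / real (Suc k)) f \<and>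
      rounded m (1 / real (Suc k)) f = q)"
  define z where "z = restrict (\<lambda>_. 0 :: real) K"
  \<comment> \<open>One representative per class; the zero function \<open>z\<close> fills in for
    empty classes, so that \<open>d\<close> stays in the carrier.\<close>
  define d where "d t = (if Ex (Q t) then SOME f. Q t f else z)" for t
  have z: "z \<in> mspace (C_space K)"
    unfolding z_def using assms by (intro restrict_in_C_space) auto
  have dQ: "Q t (d t)" if "Q t f" for t f
    using that someI[of "Q t" f] by (auto simp: d_def)
  have d: "d t \<in> mspace (C_space K)" for t
  proof (cases "Ex (Q t)")
    case True
    then show ?thesis using dQ[of t] by (cases t) (auto simp: Q_def)
  next
    case False
    then have "d t = z" unfolding d_def by (rule if_not_P)
    with z show ?thesis by simp
  qed
  have dense: "\<exists>t. mdist (C_space K) f (d t) < e" if f: "f \<in> mspace (C_space K)" and "e > 0" for f e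
  proof -
    obtain k where k: "1 / real (Suc k) < e / 4"
      using nat_approx_posE \<open>e > 0\<close> by (metis divide_pos_pos zero_less_numeral)
    define r where "r = 1 / real (Suc k)"
    have r: "r > 0" "r < e / 4" using k by (auto simp: r_def)
    have "uniformly_continuous_on K f"
      using compact_uniformly_continuous assms(1) C_space_D f by blast
    then obtain \<delta> where "\<delta> > 0" and \<delta>: "\<And>x y. x \<in> K \<Longrightarrow> y \<in> K \<Longrightarrow> dist y x < \<delta> \<Longrightarrow> dist (f y) (f x) < r"
      using r by (metis uniformly_continuous_on_def)
    obtain m where "1 / real (Suc m) < \<delta>"
      using nat_approx_posE \<open>\<delta> > 0\<close> by metis
    with \<delta> have oscf: "osc m r f"
      unfolding osc_def by (metis dist_real_def less_trans)
    define g where "g = d (m, k, rounded m r f)"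
    have "Q (m, k, rounded m r f) f"
      using f oscf by (simp add: Q_def r_def)
    from dQ[OF this] have g: "g \<in> mspace (C_space K)" "osc m r g" "rounded m r g = rounded m r f"
      by (simp_all add: Q_def g_def r_def)
    \<comment> \<open>Pass through a net point \<open>y\<close> near \<open>x\<close>: the
      oscillations of \<open>f\<close> and \<open>g\<close> cost \<open>r\<close> each, and the
      rounding at \<open>y\<close> costs a third \<open>r\<close>. The choice
      \<open>r < e / 4\<close> leaves room for the sum.\<close>
    have "\<bar>f x - g x\<bar> \<le> 3 * r" if "x \<in> K" for x
    proof -
      obtain y where y: "y \<in> set (xs m)" "y \<in> K" "dist y x < 1 / real (Suc m)"
        using xs(1)[of m] subsetD[OF xs(2)[of m] \<open>x \<in> K\<close>] by (force simp del: of_nat_Suc)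
      then have 1: "\<bar>f y - f x\<bar> < r" "\<bar>g y - g x\<bar> < r"
        using oscf g(2) \<open>x \<in> K\<close> by (auto simp: osc_def)
      have "\<lfloor>f y / r\<rfloor> = \<lfloor>g y / r\<rfloor>"
        using g(3) y(1) by (simp add: rounded_def)
      \<comment> \<open>Two reals with the same floor differ by less than 1.\<close>
      then have "\<bar>f y / r - g y / r\<bar> < 1"
        by linarith
      then have "\<bar>f y - g y\<bar> < r"
        using r by (simp add: diff_divide_distrib[symmetric] abs_divide pos_divide_less_eq)
      with 1 show ?thesis by linarith
    qed
    then have "mdist (C_space K) f g \<le> 3 * r"
      using f g assms by (intro mdist_C_space_le) auto
    with r have "mdist (C_space K) f g < e" by linarith
    then show ?thesis unfolding g_def by (rule exI)
  qed
  have "range (d \<circ> from_nat) \<subseteq> mspace (C_space K)"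
    by (rule image_subsetI) (simp only: comp_apply d)
  moreover have "\<exists>n. mdist (C_space K) f ((d \<circ> from_nat) n) < e"
    if "f \<in> mspace (C_space K)" "e > 0" for f e
    using dense[OF that] by (metis comp_apply from_nat_to_nat)
  ultimately show ?thesis
    by (intro exI[of _ "d \<circ> from_nat"]) simp
qed

section \<open>Borel maps into C(K) and their approximation by simple maps\<close>

lemma openin_subset_mspace: "openin (mtopology_of m) U \<Longrightarrow> U \<subseteq> mspace m"
  using openin_subset by fastforce

lemma space_borel_C: "space (borel_C K) = mspace (C_space K)"
  unfolding borel_C_def by (rule space_measure_of) (auto dest: openin_subset_mspace)

lemma openin_sets_borel_C: "openin (mtopology_of (C_space K)) U \<Longrightarrow> U \<in> sets (borel_C K)"
  unfolding borel_C_def by (rule in_measure_of) (auto dest: openin_subset_mspace)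

lemma measurable_borel_C_space:
  "f \<in> P \<rightarrow>\<^sub>M borel_C K \<Longrightarrow> \<omega> \<in> space P \<Longrightarrow> f \<omega> \<in> mspace (C_space K)"
  by (metis measurable_space space_borel_C)

text \<open>The strict sublevel sets are preimages of open balls around \<open>g\<close>, and open
  sets generate \<open>borel_C K\<close>.\<close>

lemma borel_measurable_mdist_C:
  assumes "f \<in> P \<rightarrow>\<^sub>M borel_C K" "g \<in> mspace (C_space K)"
  shows "(\<lambda>\<omega>. mdist (C_space K) (f \<omega>) g) \<in> borel_measurable P"
proof (rule borel_measurableI_less)
  fix y
  interpret Metric_space "mspace (C_space K)" "mdist (C_space K)" by simp
  have "{\<omega> \<in> space P. mdist (C_space K) (f \<omega>) g < y} = f -` mball g y \<inter> space P"
    using assms measurable_borel_C_space[OF assms(1)] by (auto simp: commute)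
  also have "\<dots> \<in> sets P"
    using openin_mball by (intro measurable_sets[OF assms(1)] openin_sets_borel_C) (simp add: mtopology_of_def)
  finally show "{\<omega> \<in> space P. mdist (C_space K) (f \<omega>) g < y} \<in> sets P" .
qed

text \<open>The third and fourth conclusions serve dominated convergence: all distances lie below
  the first one, and that one is the distance to a single fixed function.\<close>

lemma simple_C_approx:
  fixes K :: "'k::metric_space set"
  assumes "compact K" "K \<noteq> {}" and f: "f \<in> P \<rightarrow>\<^sub>M borel_C K"
  obtains s where "\<And>n. simple_C P K (s n)"
    and "\<And>n. (\<lambda>\<omega>. mdist (C_space K) (f \<omega>) (s n \<omega>)) \<in> borel_measurable P"
    and "\<And>n \<omega>. mdist (C_space K) (f \<omega>) (s n \<omega>) \<le> mdist (C_space K) (f \<omega>) (s 0 \<omega>)"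
    and "\<And>\<omega> \<omega>'. s 0 \<omega> = s 0 \<omega>'"
    and "\<And>\<omega>. \<omega> \<in> space P \<Longrightarrow> (\<lambda>n. mdist (C_space K) (f \<omega>) (s n \<omega>)) \<longlonglongrightarrow> 0"
proof -
  obtain c :: "nat \<Rightarrow> 'k \<Rightarrow> real" where "range c \<subseteq> mspace (C_space K)"
    and dense: "\<forall>f\<in>mspace (C_space K). \<forall>e>0. \<exists>n. mdist (C_space K) f (c n) < e"
    using separable_C_space[OF assms(1,2)] by blast
  then have c: "c n \<in> mspace (C_space K)" for n
    by blast
  let ?D = "mdist (C_space K)"
  \<comment> \<open>Greedy choice: the current candidate is replaced only by a strictly nearer one,
    so \<open>s n \<omega>\<close> is a nearest point to \<open>f \<omega>\<close> among
    \<open>c 0\<close>, ..., \<open>c n\<close>.\<close>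
  define s where "s = rec_nat (\<lambda>_. c 0)
     (\<lambda>n s \<omega>. if ?D (f \<omega>) (c (Suc n)) < ?D (f \<omega>) (s \<omega>) then c (Suc n) else s \<omega>)"
  have s_0: "s 0 = (\<lambda>_. c 0)" by (simp add: s_def)
  have s_Suc: "s (Suc n) = (\<lambda>\<omega>. if ?D (f \<omega>) (c (Suc n)) < ?D (f \<omega>) (s n \<omega>) then c (Suc n) else s n \<omega>)"
    for n unfolding s_def by simp
  note [measurable] = borel_measurable_mdist_C[OF f c]
  have meas: "(\<lambda>\<omega>. ?D (f \<omega>) (s n \<omega>)) \<in> borel_measurable P" for n
  proof (induction n)
    case (Suc n)
    \<comment> \<open>The distance to the chosen candidate is a running minimum, hence measurable.
      This in turn makes the switching sets measurable, so each \<open>s n\<close> is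
      simple.\<close>
    have "(\<lambda>\<omega>. ?D (f \<omega>) (s (Suc n) \<omega>)) = (\<lambda>\<omega>. min (?D (f \<omega>) (c (Suc n))) (?D (f \<omega>) (s n \<omega>)))"
      by (auto simp: s_Suc)
    with Suc show ?case by simp
  qed (simp add: s_0)
  have "simple_C P K (s n)" for n
  proof (induction n)
    case (Suc n)
    note meas[measurable]
    have "simple_function P (s (Suc n))"
      unfolding s_Suc using Suc
      by (intro simple_function_If) (auto simp: simple_C_def)
    with Suc c show ?case by (auto simp: simple_C_def s_Suc)
  qed (simp add: simple_C_def s_0 c)
  moreover have mono: "?D (f \<omega>) (s n \<omega>) \<le> ?D (f \<omega>) (c k)" if "k \<le> n" for n k \<omega>
    using that by (induction n) (auto simp: s_0 s_Suc le_Suc_eq)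
  moreover have "(\<lambda>n. ?D (f \<omega>) (s n \<omega>)) \<longlonglongrightarrow> 0" if "\<omega> \<in> space P" for \<omega>
  proof (rule LIMSEQ_I)
    fix e :: real assume "e > 0"
    then obtain k where "?D (f \<omega>) (c k) < e"
      using dense measurable_borel_C_space[OF f \<open>\<omega> \<in> space P\<close>] by blast
    then have "norm (?D (f \<omega>) (s n \<omega>) - 0) < e" if "n \<ge> k" for n
      using mono[OF that, of \<omega>] by simp
    then show "\<exists>k. \<forall>n\<ge>k. norm (?D (f \<omega>) (s n \<omega>) - 0) < e" by blast
  qed
  ultimately show thesis
    using that[of s] meas by (simp add: s_0)
qed

text \<open>The error at \<open>x\<close> is at most the distance in C(K), so
  \<open>f \<omega> x\<close> is a pointwise limit of real simple functions.\<close>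

lemma borel_measurable_eval_C:
  fixes K :: "'k::metric_space set"
  assumes "compact K" "f \<in> P \<rightarrow>\<^sub>M borel_C K" "x \<in> K"
  shows "(\<lambda>\<omega>. f \<omega> x) \<in> borel_measurable P"
proof -
  have "K \<noteq> {}" using assms by auto
  then obtain s where s: "\<And>n. simple_C P K (s n)"
    and lim: "\<And>\<omega>. \<omega> \<in> space P \<Longrightarrow> (\<lambda>n. mdist (C_space K) (f \<omega>) (s n \<omega>)) \<longlonglongrightarrow> 0"
    using simple_C_approx[OF assms(1) _ assms(2)] by metis
  show ?thesis
  proof (rule borel_measurable_LIMSEQ_real)
    fix n
    have "simple_function P ((\<lambda>c. c x) \<circ> s n)"
      using s by (intro simple_function_compose) (simp add: simple_C_def)
    then show "(\<lambda>\<omega>. s n \<omega> x) \<in> borel_measurable P"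
      by (auto dest: borel_measurable_simple_function simp: o_def)
  next
    fix \<omega> assume \<omega>: "\<omega> \<in> space P"
    have "\<bar>f \<omega> x - s n \<omega> x\<bar> \<le> mdist (C_space K) (f \<omega>) (s n \<omega>)" for n
      using assms \<omega> s[of n]
      by (intro abs_le_mdist_C_space) (auto simp: simple_C_def measurable_borel_C_space)
    then have "(\<lambda>n. f \<omega> x - s n \<omega> x) \<longlonglongrightarrow> 0"
      by (intro Lim_null_comparison[OF _ lim[OF \<omega>]]) auto
    then show "(\<lambda>n. s n \<omega> x) \<longlonglongrightarrow> f \<omega> x"
      using tendsto_diff[OF tendsto_const[of "f \<omega> x"]] by fastforce
  qed
qed

section \<open>The Bochner integral compared with the pointwise integral\<close>

lemma simple_integral_C_in_C_space:
  assumes "compact K" "simple_C P K s"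
  shows "simple_integral_C P K s \<in> mspace (C_space K)"
  unfolding simple_integral_C_def using assms
  by (intro restrict_in_C_space continuous_intros)
     (auto simp: simple_C_def intro!: C_space_D)

text \<open>Evaluation at \<open>x\<close> turns \<open>s\<close> into a finite combination of
  indicators of its level sets, each integrable because the measure is finite; then integrate term
  by term.\<close>

lemma (in finite_measure) simple_integral_C_eval:
  assumes "simple_C M K s" "x \<in> K"
  shows "integrable M (\<lambda>\<omega>. s \<omega> x)" "simple_integral_C M K s x = (\<integral>\<omega>. s \<omega> x \<partial>M)"
proof -
  have sf: "simple_function M s" using assms by (simp add: simple_C_def)
  then have sets: "{\<omega> \<in> space M. s \<omega> = c} \<in> sets M" if "c \<in> s ` space M" for c
    using that by (auto simp: simple_function_def vimage_def Int_def conj_commute)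
  have fin: "finite (s ` space M)" using sf by (simp add: simple_function_def)
  let ?h = "\<lambda>\<omega>. \<Sum>c\<in>s ` space M. c x * indicator {\<omega> \<in> space M. s \<omega> = c} \<omega>"
  have eq: "s \<omega> x = ?h \<omega>" if "\<omega> \<in> space M" for \<omega>
  proof -
    have "?h \<omega> = (\<Sum>c\<in>s ` space M. if s \<omega> = c then c x else 0)"
      using that by (intro sum.cong) (auto simp: indicator_def)
    then show ?thesis using fin that by (simp add: sum.delta')
  qed
  have int: "integrable M (\<lambda>\<omega>. c x * indicator {\<omega> \<in> space M. s \<omega> = c} \<omega>)"
    if "c \<in> s ` space M" for c
    using sets[OF that]
    by (intro integrable_mult_right integrable_real_indicator) (auto simp: emeasure_eq_measure)
  then have "integrable M ?h" by (rule Bochner_Integration.integrable_sum)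
  then show "integrable M (\<lambda>\<omega>. s \<omega> x)"
    by (simp add: eq cong: Bochner_Integration.integrable_cong)
  have "(\<integral>\<omega>. s \<omega> x \<partial>M) = (\<integral>\<omega>. ?h \<omega> \<partial>M)"
    by (intro Bochner_Integration.integral_cong) (simp_all add: eq)
  also have "\<dots> = (\<Sum>c\<in>s ` space M. \<integral>\<omega>. c x * indicator {\<omega> \<in> space M. s \<omega> = c} \<omega> \<partial>M)"
    using int by (rule Bochner_Integration.integral_sum)
  also have "\<dots> = simple_integral_C M K s x"
    using assms(2) by (auto simp: simple_integral_C_def mult.commute intro!: sum.cong arg_cong[where f="measure M"])
  finally show "simple_integral_C M K s x = (\<integral>\<omega>. s \<omega> x \<partial>M)" ..
qed

text \<open>The bound does not depend on \<open>x\<close>, which later yields uniform convergence.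
  It is stated in \<open>ennreal\<close> because the right side may be infinite for an unbounded
  \<open>f\<close>.\<close>

lemma (in finite_measure) simple_integral_C_error:
  assumes "compact K" "simple_C M K s" "x \<in> K"
    and f: "f \<in> space M \<rightarrow> mspace (C_space K)" and int: "integrable M (\<lambda>\<omega>. f \<omega> x)"
  shows "ennreal \<bar>simple_integral_C M K s x - (\<integral>\<omega>. f \<omega> x \<partial>M)\<bar> \<le>
    (\<integral>\<^sup>+\<omega>. ennreal (mdist (C_space K) (f \<omega>) (s \<omega>)) \<partial>M)"
proof -
  note se = simple_integral_C_eval[OF assms(2,3)]
  have "ennreal \<bar>simple_integral_C M K s x - (\<integral>\<omega>. f \<omega> x \<partial>M)\<bar> = ennreal (norm (\<integral>\<omega>. f \<omega> x - s \<omega> x \<partial>M))"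
    using se int by (simp add: abs_minus_commute)
  also have "\<dots> \<le> (\<integral>\<^sup>+\<omega>. ennreal (norm (f \<omega> x - s \<omega> x)) \<partial>M)"
    using se int by (intro integral_norm_bound_ennreal) auto
  also have "\<dots> \<le> (\<integral>\<^sup>+\<omega>. ennreal (mdist (C_space K) (f \<omega>) (s \<omega>)) \<partial>M)"
    using assms by (intro nn_integral_mono ennreal_leI)
      (auto simp: simple_C_def intro!: abs_le_mdist_C_space)
  finally show ?thesis .
qed

text \<open>Uniqueness: at \<open>x\<close> the approximating integrals tend both to
  \<open>g x\<close>, by convergence in C(K), and to the pointwise integral, by the error
  bound.\<close>

lemma (in finite_measure) has_bochner_integral_C_eval:
  assumes "compact K" "has_bochner_integral_C M K f g" "x \<in> K" "integrable M (\<lambda>\<omega>. f \<omega> x)"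
  shows "g x = (\<integral>\<omega>. f \<omega> x \<partial>M)"
proof -
  obtain s where f: "f \<in> M \<rightarrow>\<^sub>M borel_C K" and s: "\<And>n. simple_C M K (s n)"
    and lim0: "(\<lambda>n. \<integral>\<^sup>+\<omega>. ennreal (mdist (C_space K) (f \<omega>) (s n \<omega>)) \<partial>M) \<longlonglongrightarrow> 0"
    and lim: "limitin (mtopology_of (C_space K)) (\<lambda>n. simple_integral_C M K (s n)) g sequentially"
    using assms(2) by (auto simp: has_bochner_integral_C_def)
  have "(\<lambda>n. ennreal \<bar>simple_integral_C M K (s n) x - (\<integral>\<omega>. f \<omega> x \<partial>M)\<bar>) \<longlonglongrightarrow> 0"
    using assms s f
    by (intro tendsto_sandwich[OF _ _ tendsto_const lim0] always_eventually allI simple_integral_C_error)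
       (auto intro: measurable_borel_C_space)
  then have "(\<lambda>n. \<bar>simple_integral_C M K (s n) x - (\<integral>\<omega>. f \<omega> x \<partial>M)\<bar>) \<longlonglongrightarrow> 0"
    \<comment> \<open>Writing the limit as \<open>ennreal 0\<close> lets the convergence be
      transferred back to the reals.\<close>
    by (subst (asm) ennreal_0[symmetric]) (subst (asm) tendsto_ennreal_iff, auto)
  then have "(\<lambda>n. simple_integral_C M K (s n) x) \<longlonglongrightarrow> (\<integral>\<omega>. f \<omega> x \<partial>M)"
    using LIM_zero_cancel tendsto_rabs_zero_iff by blast
  then show ?thesis
    using limitin_C_space_pointwise[OF assms(1) lim assms(3)] LIMSEQ_unique by blast
qed

lemma (in finite_measure) has_bochner_integral_C_bounded:
  fixes K :: "'k::metric_space set"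
  assumes "compact K" "K \<noteq> {}" and f: "f \<in> M \<rightarrow>\<^sub>M borel_C K"
    and B: "\<And>\<omega> x. \<omega> \<in> space M \<Longrightarrow> x \<in> K \<Longrightarrow> \<bar>f \<omega> x\<bar> \<le> B"
  shows "\<And>x. x \<in> K \<Longrightarrow> integrable M (\<lambda>\<omega>. f \<omega> x)"
    and "has_bochner_integral_C M K f (\<lambda>x\<in>K. \<integral>\<omega>. f \<omega> x \<partial>M)"
proof -
  let ?D = "mdist (C_space K)"
  show int: "integrable M (\<lambda>\<omega>. f \<omega> x)" if "x \<in> K" for x
    using that B borel_measurable_eval_C[OF assms(1) f that]
    by (intro integrable_const_bound[where B=B]) auto
  obtain s where s: "\<And>n. simple_C M K (s n)"
    and meas: "\<And>n. (\<lambda>\<omega>. ?D (f \<omega>) (s n \<omega>)) \<in> borel_measurable M"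
    and le: "\<And>n \<omega>. ?D (f \<omega>) (s n \<omega>) \<le> ?D (f \<omega>) (s 0 \<omega>)"
    and const: "\<And>\<omega> \<omega>'. s 0 \<omega> = s 0 \<omega>'"
    and lim: "\<And>\<omega>. \<omega> \<in> space M \<Longrightarrow> (\<lambda>n. ?D (f \<omega>) (s n \<omega>)) \<longlonglongrightarrow> 0"
    using assms(1-3) by (rule simple_C_approx) (rule that)
  have "\<exists>B'. \<forall>\<omega>\<in>space M. ?D (f \<omega>) (s 0 \<omega>) \<le> B'"
  \<comment> \<open>A finite measure may live on an empty space; otherwise any point names the
    constant value of \<open>s 0\<close>.\<close>
  proof (cases "space M = {}")
    case False
    then obtain \<omega>0 where \<omega>0: "\<omega>0 \<in> space M" by blast
    let ?c = "s 0 \<omega>0"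
    have c: "?c \<in> mspace (C_space K)"
      using s[of 0] \<omega>0 by (auto simp: simple_C_def)
    have "continuous_on K ?c" using C_space_D assms(1) c by blast
    then obtain C where C: "\<And>x. x \<in> K \<Longrightarrow> \<bar>?c x\<bar> \<le> C"
      using compact_continuous_image[OF _ assms(1)] compact_imp_bounded
      by (force simp: bounded_iff)
    have "?D (f \<omega>) (s 0 \<omega>) \<le> B + C" if "\<omega> \<in> space M" for \<omega>
    proof -
      have "\<bar>f \<omega> x - ?c x\<bar> \<le> B + C" if "x \<in> K" for x
        using B[OF \<open>\<omega> \<in> space M\<close> that] C[OF that] by linarith
      then have "?D (f \<omega>) ?c \<le> B + C"
        using c assms(2) measurable_borel_C_space[OF f that] by (intro mdist_C_space_le) auto
      then show ?thesis using const by metis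
    qed
    then show ?thesis by blast
  qed auto
  then obtain B' where B': "\<And>\<omega>. \<omega> \<in> space M \<Longrightarrow> ?D (f \<omega>) (s 0 \<omega>) \<le> B'" by blast
  define \<epsilon> where "\<epsilon> n = (\<integral>\<omega>. ?D (f \<omega>) (s n \<omega>) \<partial>M)" for n
  have bd: "norm (?D (f \<omega>) (s n \<omega>)) \<le> B'" if "\<omega> \<in> space M" for \<omega> n
    using le[of \<omega> n] B'[OF that] by simp
  have intD: "integrable M (\<lambda>\<omega>. ?D (f \<omega>) (s n \<omega>))" for n
    using bd meas by (intro integrable_const_bound[where B=B']) auto
  have "\<epsilon> \<longlonglongrightarrow> (\<integral>\<omega>. 0 \<partial>M)"
    unfolding \<epsilon>_def
    by (rule integral_dominated_convergence[where w="\<lambda>_. B'"]) (use meas lim bd in auto)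
  then have \<epsilon>0: "\<epsilon> \<longlonglongrightarrow> 0" by simp
  have nn: "(\<integral>\<^sup>+\<omega>. ennreal (?D (f \<omega>) (s n \<omega>)) \<partial>M) = ennreal (\<epsilon> n)" for n
    unfolding \<epsilon>_def using intD by (intro nn_integral_eq_integral) auto
  have \<epsilon>_ge: "0 \<le> \<epsilon> n" for n
    unfolding \<epsilon>_def by simp
  let ?g = "\<lambda>x\<in>K. \<integral>\<omega>. f \<omega> x \<partial>M"
  \<comment> \<open>The nonnegative integral is the real number \<open>\<epsilon> n\<close>, so the
    extended error bound becomes a real one, uniform over \<open>K\<close>.\<close>
  have err: "\<bar>simple_integral_C M K (s n) x - ?g x\<bar> \<le> \<epsilon> n" if "x \<in> K" for n x
    using simple_integral_C_error[where f=f, OF assms(1) s[of n] that _ int[OF that]] that f \<epsilon>_ge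
    by (auto simp: nn Pi_iff measurable_borel_C_space)
  have "uniform_limit K (\<lambda>n. simple_integral_C M K (s n)) ?g sequentially"
  proof (rule uniform_limitI)
    fix e :: real assume "e > 0"
    with \<epsilon>0 have "\<forall>\<^sub>F n in sequentially. \<epsilon> n < e"
      by (simp add: order_tendsto_iff)
    then show "\<forall>\<^sub>F n in sequentially. \<forall>x\<in>K. dist (simple_integral_C M K (s n) x) (?g x) < e"
    proof eventually_elim
      case (elim n)
      show ?case
      proof
        fix x assume "x \<in> K"
        from err[OF this, of n] elim show "dist (simple_integral_C M K (s n) x) (?g x) < e"
          unfolding dist_real_def by linarith
      qed
    qed
  qed
  then have "limitin (mtopology_of (C_space K)) (\<lambda>n. simple_integral_C M K (s n)) ?g sequentially"
    using assms s by (intro limitin_C_spaceI simple_integral_C_in_C_space) auto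
  moreover have "(\<lambda>n. \<integral>\<^sup>+\<omega>. ennreal (?D (f \<omega>) (s n \<omega>)) \<partial>M) \<longlonglongrightarrow> 0"
    unfolding nn using tendsto_ennrealI[OF \<epsilon>0] by simp
  ultimately show "has_bochner_integral_C M K f ?g"
    unfolding has_bochner_integral_C_def using f s by blast
qed

lemma has_bochner_integral_C_in_C_space:
  "has_bochner_integral_C P K f g \<Longrightarrow> g \<in> mspace (C_space K)"
  by (auto simp: has_bochner_integral_C_def limitin_C_space_iff)

text \<open>Two Bochner integrals agree on \<open>K\<close> with the pointwise integral and outside
  \<open>K\<close> by extensionality, so the \<open>THE\<close> is determined.\<close>

lemma (in finite_measure) bochner_integral_C_eqI:
  assumes "compact K" "has_bochner_integral_C M K f g"
    and int: "\<And>x. x \<in> K \<Longrightarrow> integrable M (\<lambda>\<omega>. f \<omega> x)"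
  shows "bochner_integral_C M K f = g"
  unfolding bochner_integral_C_def
proof (rule the_equality)
  fix h assume h: "has_bochner_integral_C M K f h"
  have "h \<in> extensional K" "g \<in> extensional K"
    using assms h has_bochner_integral_C_in_C_space C_space_D by blast+
  moreover have "h x = g x" if "x \<in> K" for x
    using that assms h has_bochner_integral_C_eval int by metis
  ultimately show "h = g" by (rule extensionalityI)
qed (rule assms(2))

section \<open>The cube and the expected value of a random mean\<close>

lemma compact_cube:
  assumes "is_interval I" "compact I"
  shows "compact (cube I :: (real ^ 'p) set)"
proof -
  obtain a b where "I = {a..b}"
    using assms connected_compact_interval_1 is_interval_connected by blast
  then have "cube I = cbox (\<chi> i. a) (\<chi> i. b :: real ^ 'p)"
    by (auto simp: cube_def mem_box_cart)
  then show ?thesis by simp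
qed

lemma cube_nonempty: "a \<in> I \<Longrightarrow> (\<chi> i. a) \<in> cube I"
  by (simp add: cube_def)

text \<open>The least and greatest coordinates are themselves coordinates, hence points of
  \<open>I\<close>. The bound is common to all means, so it bounds a random mean uniformly in the
  outcome.\<close>

lemma means_bounded:
  fixes x :: "real ^ 'p"
  assumes "m \<in> means I" "\<And>a. a \<in> I \<Longrightarrow> \<bar>a\<bar> \<le> B" "x \<in> cube I"
  shows "\<bar>m x\<bar> \<le> B"
proof -
  have "Min (range (($) x)) \<in> range (($) x)" "Max (range (($) x)) \<in> range (($) x)"
    by (rule Min_in Max_in; simp)+
  moreover have "range (($) x) \<subseteq> I"
    using assms(3) by (auto simp: cube_def)
  ultimately have "\<bar>Min (range (($) x))\<bar> \<le> B" "\<bar>Max (range (($) x))\<bar> \<le> B"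
    using assms(2) by blast+
  moreover have "Min (range (($) x)) \<le> m x" "m x \<le> Max (range (($) x))"
    using assms by (auto simp: means_def)
  ultimately show ?thesis by linarith
qed

theorem theorem2p10:
  fixes I :: "real set"
    and P :: "'w measure"
    and \<xi> :: "'w \<Rightarrow> real ^ 'd"
    and M :: "'w \<Rightarrow> real ^ 'p \<Rightarrow> real"
  assumes "is_interval I" and "compact I" and "\<exists>a\<in>I. \<exists>b\<in>I. a \<noteq> b"
    and "prob_space P"
    and "\<xi> \<in> P \<rightarrow>\<^sub>M borel"
    and "random_mean P I \<xi> M"
  shows "bochner_integrable_C P (cube I) M \<and>
    expected_mean P I M \<in> means I \<and>
    (\<forall>x\<in>cube I. integrable P (\<lambda>\<omega>. M \<omega> x) \<and>
       expected_mean P I M x = (\<integral>\<omega>. M \<omega> x \<partial>P))"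
proof -
  interpret prob_space P by fact
  let ?K = "cube I :: (real ^ 'p) set"
  let ?g = "\<lambda>x\<in>?K. \<integral>\<omega>. M \<omega> x \<partial>P"
  have K: "compact ?K" "?K \<noteq> {}"
    using compact_cube[OF assms(1,2)] cube_nonempty assms(3) by blast+
  have M: "\<And>\<omega>. \<omega> \<in> space P \<Longrightarrow> M \<omega> \<in> means I" "M \<in> P \<rightarrow>\<^sub>M borel_C ?K"
    using assms(6) by (auto simp: random_mean_def)
  obtain B where "\<And>a. a \<in> I \<Longrightarrow> \<bar>a\<bar> \<le> B"
    using compact_imp_bounded[OF assms(2)] by (auto simp: bounded_iff)
  then have bd: "\<bar>M \<omega> x\<bar> \<le> B" if "\<omega> \<in> space P" "x \<in> ?K" for \<omega> x
    using that M means_bounded by blast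
  have int: "integrable P (\<lambda>\<omega>. M \<omega> x)" if "x \<in> ?K" for x
    using K M(2) bd that by (rule has_bochner_integral_C_bounded(1))
  have has: "has_bochner_integral_C P ?K M ?g"
    using K M(2) bd by (rule has_bochner_integral_C_bounded(2))
  have E: "expected_mean P I M = ?g"
    unfolding expected_mean_def using K(1) has int by (rule bochner_integral_C_eqI)
  \<comment> \<open>As the total mass is 1, constant bounds on the integrand pass unchanged to the
    integral.\<close>
  have "Min (range (($) x)) \<le> ?g x \<and> ?g x \<le> Max (range (($) x))" if "x \<in> ?K" for x
    using that M(1) int[OF that]
    by (auto simp: means_def intro!: integral_ge_const integral_le_const)
  then have "?g \<in> means I"
    using has_bochner_integral_C_in_C_space[OF has] by (simp add: means_def)
  then show ?thesis
    unfolding E bochner_integrable_C_def using has int by auto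
qed

end
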